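(* Every Colombeau generalized number $a\in\overline{\mathbb{C}}$ has a $v$-asymptotic expansion in $\overline{\mathbb{C}}$. More precisely, let $C$ be a vector subspace of $\overline{\mathbb{C}}$ (over $\mathbb{C}$) which is maximal in $\mathcal{C}_v(\overline{\mathbb{C}})$. Then every $a\in\overline{\mathbb{C}}$ has a unique $v$-asymptotic expansion $$a\leadsto\sum_{n=0}^\infty\frac{a_n}{\lambda^{r_n}}$$ with all coefficients $a_n$ in $C$.
   Context: $G_\infty(\mathbb{R},\mathbb{C})$ is the ring (pointwise operations) of germs at $+\infty$ of complex valued functions defined on a subset of $\mathbb{R}$ containing some $(n,\infty)$, $n\in\mathbb{N}$. $\mathcal{M}=\{f\in G_\infty(\mathbb{R},\mathbb{C}): f(x)=O(x^n)\text{ as }x\to\infty\text{ for some }n\in\mathbb{N}\}$, $\mathcal{N}=\{f\in G_\infty(\mathbb{R},\mathbb{C}): f(x)=O(1/x^n)\text{ for all }n\in\mathbb{N}\}$, and for $f\in\mathcal{M}$, $v(f)=\sup\{r\in\mathbb{R}: f(x)=O(1/x^r)\text{ as }x\to\infty\}\in\mathbb{R}\cup\{\infty\}$. Colombeau's ring of complex generalized numbers is the quotient ring $\overline{\mathbb{C}}=\mathcal{M}/\mathcal{N}$ with quotient map $q:\mathcal{M}\to\overline{\mathbb{C}}$; put $v(q(f))=v(f)$ (well defined). $\lambda=q(\mathrm{id})$, where $\mathrm{id}(x)=x$, and $\lambda^{r}=q(x^r)$ for $r\in\mathbb{R}$. $\mathcal{C}_v(\overline{\mathbb{C}})=\{a\in\overline{\mathbb{C}}: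 v(a)=0\}$; $\mathbb{C}$ is embedded in $\overline{\mathbb{C}}$ via constant functions. A vector subspace $C$ of $\overline{\mathbb{C}}$ is maximal in $\mathcal{C}_v(\overline{\mathbb{C}})$ if $\mathbb{C}\subset C\subset\mathcal{C}_v(\overline{\mathbb{C}})\cup\{0\}$ and there is no vector subspace $\mathbb{K}$ of $\overline{\mathbb{C}}$ with $C\subsetneqq\mathbb{K}\subset\mathcal{C}_v(\overline{\mathbb{C}})\cup\{0\}$. A set $\mathbb{F}\subset\overline{\mathbb{C}}$ is linearly $v$-independent over $\mathbb{C}$ if $v(a)=0$ for all nonzero $a\in\mathrm{Span}_{\mathbb{C}}(\mathbb{F})$. A $v$-asymptotic series in $\overline{\mathbb{C}}$ is a formal series $\sum_{n=0}^\infty a_n/\lambda^{r_n}$ given by sequences $a_n\in\overline{\mathbb{C}}$, $r_n\in\mathbb{R}\cup\{\infty\}$ such that: (a) $\{a_n: n\ge0\}$ is linearly $v$-independent over $\mathbb{C}$; (b) $r_n=\infty$ if and only if $a_n=0$, if and only if $a_m=0$ for all $m\ge n$; and $(r_n)$ restricted to $\{n: a_n\neq0\}$ is a strictly increasing (finite or infinite) sequence in $\mathbb{R}$. By convention $0/\lambda^\infty=0$. Such a series is a $v$-asymptotic expansion of $a\in\overline{\mathbb{C}}$, written $a\leadsto\sum_{n=0}^\infty a_n/\lambda^{r_n}$, if for every $n\ge0$ with $a_n\ne0$ one has $v\big(a-\sum_{k=0}^n a_k/\lambda^{r_k}\big)>r_n$, and for every $n\ge0$ with $a_n=0$ one has $a=\sum_{k=0}^{n-1}a_k/\lambda^{r_k}$.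 *)

theory Defs
  imports Complex_Main "HOL-Library.Landau_Symbols" "HOL-Library.Extended_Real"
begin

section \<open>Germs at infinity\<close>

text \<open>
  A function defined on a subset of the reals containing some interval \<open>(n, \<infinity>)\<close> has the same germ
  at \<open>+\<infinity>\<close> as each of its extensions to the whole line, so it suffices to take the germs of total
  functions. Similarly, \<open>x powr r\<close> is the usual power \<open>x\<^sup>r\<close> only for positive \<open>x\<close>, which is all that matters
  for the germ.
\<close>

quotient_type germ = "real \<Rightarrow> complex" / "\<lambda>f g. eventually (\<lambda>x. f x = g x) at_top"
proof (rule equivpI)
  show "reflp (\<lambda>f g :: real \<Rightarrow> complex. eventually (\<lambda>x. f x = g x) at_top)"
    by (auto intro: reflpI)
  show "symp (\<lambda>f g :: real \<Rightarrow> complex. eventually (\<lambda>x. f x = g x) at_top)"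
    by (auto intro!: sympI elim: eventually_mono)
  show "transp (\<lambda>f g :: real \<Rightarrow> complex. eventually (\<lambda>x. f x = g x) at_top)"
    by (rule transpI) (auto elim: eventually_elim2)
qed

instantiation germ :: comm_ring_1
begin

lift_definition zero_germ :: germ is "\<lambda>_. 0" .
lift_definition one_germ :: germ is "\<lambda>_. 1" .
lift_definition plus_germ :: "germ \<Rightarrow> germ \<Rightarrow> germ" is "\<lambda>f g x. f x + g x"
  by (erule (1) eventually_elim2) simp
lift_definition minus_germ :: "germ \<Rightarrow> germ \<Rightarrow> germ" is "\<lambda>f g x. f x - g x"
  by (erule (1) eventually_elim2) simp
lift_definition uminus_germ :: "germ \<Rightarrow> germ" is "\<lambda>f x. - f x"
  by (auto elim: eventually_mono)
lift_definition times_germ :: "germ \<Rightarrow> germ \<Rightarrow> germ" is "\<lambda>f g x. f x * g x"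
  by (erule (1) eventually_elim2) simp

instance
  by standard (transfer, simp add: algebra_simps)+

end

lift_definition germ_bigo :: "germ \<Rightarrow> (real \<Rightarrow> real) \<Rightarrow> bool"
  is "\<lambda>f g. f \<in> O[at_top](\<lambda>x. complex_of_real (g x))"
  by (rule ext) (rule landau_o.big.in_cong)

definition moderate :: "germ set" where
  "moderate = {f. \<exists>n::nat. germ_bigo f (\<lambda>x. x ^ n)}"

definition negligible :: "germ set" where
  "negligible = {f. \<forall>n::nat. germ_bigo f (\<lambda>x. 1 / x ^ n)}"

definition germ_val :: "germ \<Rightarrow> ereal" where
  "germ_val f = Sup (ereal ` {r. germ_bigo f (\<lambda>x. 1 / x powr r)})"

lift_definition germ_const :: "complex \<Rightarrow> germ" is "\<lambda>z _. z" .

lift_definition germ_powr :: "real \<Rightarrow> germ" is "\<lambda>r x. complex_of_real (x powr r)" .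

lemma germ_bigo_add: "germ_bigo f h \<Longrightarrow> germ_bigo g h \<Longrightarrow> germ_bigo (f + g) h"
  by transfer (rule sum_in_bigo)

lemma germ_bigo_diff: "germ_bigo f h \<Longrightarrow> germ_bigo g h \<Longrightarrow> germ_bigo (f - g) h"
  by transfer (rule sum_in_bigo)

lemma germ_bigo_uminus: "germ_bigo f h \<Longrightarrow> germ_bigo (- f) h"
  by transfer simp

lemma germ_bigo_zero: "germ_bigo 0 h"
  by transfer simp

lemma germ_bigo_mult:
  "germ_bigo f h \<Longrightarrow> germ_bigo g k \<Longrightarrow> germ_bigo (f * g) (\<lambda>x. h x * k x)"
  by transfer (simp add: landau_o.big.mult)

lemma germ_bigo_mono:
  assumes "germ_bigo f h" "eventually (\<lambda>x. \<bar>h x\<bar> \<le> \<bar>k x\<bar>) at_top"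
  shows "germ_bigo f k"
  using assms
proof transfer
  fix f :: "real \<Rightarrow> complex" and h k :: "real \<Rightarrow> real"
  assume f: "f \<in> O(\<lambda>x. complex_of_real (h x))" and le: "eventually (\<lambda>x. \<bar>h x\<bar> \<le> \<bar>k x\<bar>) at_top"
  have "(\<lambda>x. complex_of_real (h x)) \<in> O(\<lambda>x. complex_of_real (k x))"
    by (rule bigoI[where c = 1]) (use le in \<open>simp add: norm_of_real\<close>)
  with f show "f \<in> O(\<lambda>x. complex_of_real (k x))"
    by (rule landau_o.big_trans)
qed

lemma moderate_add: "f \<in> moderate \<Longrightarrow> g \<in> moderate \<Longrightarrow> f + g \<in> moderate"
proof -
  assume "f \<in> moderate" "g \<in> moderate"
  then obtain m n where mn: "germ_bigo f (\<lambda>x. x ^ m)" "germ_bigo g (\<lambda>x. x ^ n)"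
    by (auto simp: moderate_def)
  have *: "eventually (\<lambda>x. \<bar>x ^ i\<bar> \<le> \<bar>x ^ (m + n)\<bar>) (at_top :: real filter)" if "i \<le> m + n" for i
    using eventually_ge_at_top[of "1::real"]
    by eventually_elim (use that in \<open>simp add: power_increasing\<close>)
  have "germ_bigo (f + g) (\<lambda>x. x ^ (m + n))"
    by (rule germ_bigo_add; rule germ_bigo_mono, (rule mn), rule *) auto
  then show ?thesis by (auto simp: moderate_def)
qed

lemma moderate_uminus: "f \<in> moderate \<Longrightarrow> - f \<in> moderate"
  by (auto simp: moderate_def intro: germ_bigo_uminus)

lemma moderate_diff: "f \<in> moderate \<Longrightarrow> g \<in> moderate \<Longrightarrow> f - g \<in> moderate"
  using moderate_add[of f "- g"] moderate_uminus[of g] by simp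

lemma moderate_mult: "f \<in> moderate \<Longrightarrow> g \<in> moderate \<Longrightarrow> f * g \<in> moderate"
proof -
  assume "f \<in> moderate" "g \<in> moderate"
  then obtain m n where "germ_bigo f (\<lambda>x. x ^ m)" "germ_bigo g (\<lambda>x. x ^ n)"
    by (auto simp: moderate_def)
  then have "germ_bigo (f * g) (\<lambda>x. x ^ (m + n))"
    unfolding power_add by (rule germ_bigo_mult)
  then show ?thesis by (auto simp: moderate_def)
qed

lemma moderate_const: "germ_const z \<in> moderate"
proof -
  have "germ_bigo (germ_const z) (\<lambda>x. x ^ 0)"
    by transfer simp
  then show ?thesis unfolding moderate_def by blast
qed

lemma germ_const_0: "germ_const 0 = 0" and germ_const_1: "germ_const 1 = 1"
  by (transfer, simp)+

lemma moderate_0: "0 \<in> moderate" and moderate_1: "1 \<in> moderate"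
  using moderate_const[of 0] moderate_const[of 1] by (simp_all add: germ_const_0 germ_const_1)

lemma moderate_powr: "germ_powr r \<in> moderate"
proof -
  obtain n :: nat where n: "r \<le> real n" using real_arch_simple by blast
  have "germ_bigo (germ_powr r) (\<lambda>x. x powr r)"
    by transfer simp
  moreover have "eventually (\<lambda>x. \<bar>x powr r\<bar> \<le> \<bar>x ^ n\<bar>) at_top"
    using eventually_ge_at_top[of "1::real"]
  proof eventually_elim
    case (elim x)
    then have "x powr r \<le> x powr real n" using n by (intro powr_mono) auto
    with elim show ?case by (simp add: powr_realpow)
  qed
  ultimately have "germ_bigo (germ_powr r) (\<lambda>x. x ^ n)" by (rule germ_bigo_mono)
  then show ?thesis by (auto simp: moderate_def)
qed

lemma negligible_0: "0 \<in> negligible"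
  by (simp add: negligible_def germ_bigo_zero)

lemma negligible_add: "f \<in> negligible \<Longrightarrow> g \<in> negligible \<Longrightarrow> f + g \<in> negligible"
  by (simp add: negligible_def germ_bigo_add)

lemma negligible_uminus: "f \<in> negligible \<Longrightarrow> - f \<in> negligible"
  by (simp add: negligible_def germ_bigo_uminus)

lemma negligible_mult:
  assumes "f \<in> moderate" "g \<in> negligible"
  shows "f * g \<in> negligible"
proof -
  obtain m where m: "germ_bigo f (\<lambda>x. x ^ m)" using assms by (auto simp: moderate_def)
  have "germ_bigo (f * g) (\<lambda>x. 1 / x ^ n)" for n
  proof (rule germ_bigo_mono)
    show "germ_bigo (f * g) (\<lambda>x. x ^ m * (1 / x ^ (m + n)))"
      using assms(2) by (intro germ_bigo_mult m) (simp add: negligible_def)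
    show "eventually (\<lambda>x. \<bar>x ^ m * (1 / x ^ (m + n))\<bar> \<le> \<bar>1 / x ^ n\<bar>) (at_top :: real filter)"
      using eventually_gt_at_top[of "0::real"] by eventually_elim (simp add: power_add)
  qed
  then show ?thesis by (simp add: negligible_def)
qed

lemma germ_bigo_negligible:
  assumes "g \<in> negligible"
  shows "germ_bigo g (\<lambda>x. 1 / x powr r)"
proof -
  obtain n :: nat where n: "r \<le> real n" using real_arch_simple by blast
  show ?thesis
  proof (rule germ_bigo_mono)
    show "germ_bigo g (\<lambda>x. 1 / x ^ n)" using assms by (simp add: negligible_def)
    show "eventually (\<lambda>x. \<bar>1 / x ^ n\<bar> \<le> \<bar>1 / x powr r\<bar>) at_top"
      using eventually_ge_at_top[of "1::real"]
    proof eventually_elim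
      case (elim x)
      then have "x powr r \<le> x powr real n" using n by (intro powr_mono) auto
      with elim show ?case by (simp add: powr_realpow frac_le)
    qed
  qed
qed

lemma germ_val_cong:
  assumes "f - g \<in> negligible"
  shows "germ_val f = germ_val g"
proof -
  have "germ_bigo f (\<lambda>x. 1 / x powr r) \<longleftrightarrow> germ_bigo g (\<lambda>x. 1 / x powr r)" for r
    using germ_bigo_add[OF _ germ_bigo_negligible[OF assms, of r], of g]
      germ_bigo_diff[OF _ germ_bigo_negligible[OF assms, of r], of f] by auto
  then show ?thesis by (simp add: germ_val_def)
qed

lemma one_not_negligible: "1 \<notin> negligible"
proof
  assume "1 \<in> negligible"
  then have "germ_bigo 1 (\<lambda>x. 1 / x ^ 1)" unfolding negligible_def by blast
  then have "(\<lambda>_. 1 :: complex) \<in> O[at_top](\<lambda>x::real. complex_of_real (1 / x ^ 1))"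
    by transfer
  then obtain c where "eventually (\<lambda>x::real. norm (1::complex) \<le> c * norm (complex_of_real (1 / x ^ 1))) at_top"
    by (elim landau_o.bigE)
  then have "eventually (\<lambda>x::real. False) at_top"
    using eventually_gt_at_top[of "max 1 c"]
  proof eventually_elim
    case (elim x)
    then show ?case by (simp add: norm_divide field_simps)
  qed
  then show False by (simp add: trivial_limit_at_top_linorder)
qed


section \<open>Colombeau generalized numbers\<close>

quotient_type colombeau = germ / partial: "\<lambda>f g. f \<in> moderate \<and> g \<in> moderate \<and> f - g \<in> negligible"
proof (rule part_equivpI)
  show "\<exists>f. f \<in> moderate \<and> f \<in> moderate \<and> f - f \<in> negligible"
    using moderate_0 negligible_0 by (intro exI[of _ 0]) simp
  show "symp (\<lambda>f g. f \<in> moderate \<and> g \<in> moderate \<and> f - g \<in> negligible)"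
    by (rule sympI) (auto dest: negligible_uminus)
  show "transp (\<lambda>f g. f \<in> moderate \<and> g \<in> moderate \<and> f - g \<in> negligible)"
    by (rule transpI) (auto dest: negligible_add)
qed

instantiation colombeau :: comm_ring_1
begin

lift_definition zero_colombeau :: colombeau is 0
  by (simp add: moderate_0 negligible_0)
lift_definition one_colombeau :: colombeau is 1
  by (simp add: moderate_1 negligible_0)
lift_definition plus_colombeau :: "colombeau \<Rightarrow> colombeau \<Rightarrow> colombeau" is "(+)"
  by (simp add: moderate_add negligible_add add_diff_add)
lift_definition uminus_colombeau :: "colombeau \<Rightarrow> colombeau" is uminus
  by (simp only: moderate_uminus negligible_uminus minus_diff_minus simp_thms)
lift_definition minus_colombeau :: "colombeau \<Rightarrow> colombeau \<Rightarrow> colombeau" is "(-)"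
proof -
  fix f f' g g' :: germ
  assume *: "f \<in> moderate \<and> f' \<in> moderate \<and> f - f' \<in> negligible"
    "g \<in> moderate \<and> g' \<in> moderate \<and> g - g' \<in> negligible"
  have "f - g - (f' - g') = (f - f') + - (g - g')" by simp
  with * show "f - g \<in> moderate \<and> f' - g' \<in> moderate \<and> f - g - (f' - g') \<in> negligible"
    by (simp only: moderate_diff negligible_add negligible_uminus simp_thms)
qed
lift_definition times_colombeau :: "colombeau \<Rightarrow> colombeau \<Rightarrow> colombeau" is "(*)"
proof -
  fix f f' g g' :: germ
  assume *: "f \<in> moderate \<and> f' \<in> moderate \<and> f - f' \<in> negligible"
    "g \<in> moderate \<and> g' \<in> moderate \<and> g - g' \<in> negligible"
  have "f * g - f' * g' = f * (g - g') + g' * (f - f')" by (simp add: algebra_simps)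
  with * show "f * g \<in> moderate \<and> f' * g' \<in> moderate \<and> f * g - f' * g' \<in> negligible"
    by (simp only: moderate_mult negligible_add negligible_mult simp_thms)
qed

instance
proof
  fix a b c :: colombeau
  show "a + b + c = a + (b + c)"
    by transfer (simp add: add.assoc moderate_add negligible_0)
  show "a + b = b + a"
    by transfer (simp add: add.commute moderate_add negligible_0)
  show "0 + a = a"
    by transfer simp
  show "- a + a = 0"
    by transfer (simp add: moderate_0 negligible_0)
  show "a - b = a + - b"
    by transfer (simp add: moderate_add moderate_diff moderate_uminus negligible_0)
  show "a * b * c = a * (b * c)"
    by transfer (simp add: mult.assoc moderate_mult negligible_0)
  show "a * b = b * a"
    by transfer (simp add: mult.commute moderate_mult negligible_0)
  show "1 * a = a"
    by transfer simp
  show "(a + b) * c = a * c + b * c"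
    by transfer (simp add: distrib_right moderate_add moderate_mult negligible_0)
  show "(0::colombeau) \<noteq> 1"
    using one_not_negligible by transfer (auto dest: negligible_uminus)
qed

end

lift_definition val :: "colombeau \<Rightarrow> ereal" is germ_val
  by (auto intro: germ_val_cong)

lift_definition const :: "complex \<Rightarrow> colombeau" is germ_const
  by (simp add: moderate_const negligible_0)

lift_definition lambda_powr :: "real \<Rightarrow> colombeau" is germ_powr
  by (simp add: moderate_powr negligible_0)

lemma lambda_powr_0: "lambda_powr 0 = 1"
proof -
  have "germ_powr 0 = 1"
    by transfer (auto intro: eventually_mono[OF eventually_gt_at_top[of 0]])
  then show ?thesis
    by transfer (simp add: moderate_1 negligible_0)
qed

lemma lambda_powr_add: "lambda_powr (r + s) = lambda_powr r * lambda_powr s"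
proof -
  have "germ_powr (r + s) = germ_powr r * germ_powr s"
    by transfer (simp add: powr_add)
  then show ?thesis
    by transfer (simp add: moderate_powr moderate_mult negligible_0)
qed

lemma lambda_powr_minus: "lambda_powr r * lambda_powr (- r) = 1"
  by (simp add: lambda_powr_add[symmetric] lambda_powr_0)

lemma const_add: "const (y + z) = const y + const z"
proof -
  have "germ_const (y + z) = germ_const y + germ_const z" by transfer simp
  then show ?thesis by transfer (simp add: moderate_const moderate_add negligible_0)
qed

lemma const_mult: "const (y * z) = const y * const z"
proof -
  have "germ_const (y * z) = germ_const y * germ_const z" by transfer simp
  then show ?thesis by transfer (simp add: moderate_const moderate_mult negligible_0)
qed

lemma const_1: "const 1 = 1"
  by transfer (simp add: germ_const_1 moderate_1 negligible_0)

definition scale :: "complex \<Rightarrow> colombeau \<Rightarrow> colombeau" where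
  "scale z a = const z * a"

global_interpretation colombeau: vector_space scale
  by standard (simp_all add: scale_def const_add const_mult const_1 distrib_left distrib_right mult.assoc)


section \<open>Asymptotic expansions with respect to the valuation\<close>

definition val_zero :: "colombeau set" where
  "val_zero = {a. val a = 0}"

definition maximal_in_val_zero :: "colombeau set \<Rightarrow> bool" where
  "maximal_in_val_zero C \<longleftrightarrow>
     colombeau.subspace C \<and> range const \<subseteq> C \<and> C \<subseteq> val_zero \<union> {0} \<and>
     \<not> (\<exists>K. colombeau.subspace K \<and> C \<subset> K \<and> K \<subseteq> val_zero \<union> {0})"

definition lin_val_independent :: "colombeau set \<Rightarrow> bool" where
  "lin_val_independent F \<longleftrightarrow> (\<forall>a \<in> colombeau.span F. a \<noteq> 0 \<longrightarrow> val a = 0)"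

text \<open>
  Exponents live in \<open>\<real> \<union> {\<infinity>}\<close>, rendered as extended reals different from \<open>-\<infinity>\<close>. A formal series
  with coefficients \<open>a\<^sub>n\<close> and exponents \<open>r\<^sub>n\<close> is the pair of the two sequences.
\<close>

definition val_asymptotic_series :: "(nat \<Rightarrow> colombeau) \<Rightarrow> (nat \<Rightarrow> ereal) \<Rightarrow> bool" where
  "val_asymptotic_series a r \<longleftrightarrow>
     (\<forall>n. r n \<noteq> -\<infinity>) \<and>
     lin_val_independent (range a) \<and>
     (\<forall>n. r n = \<infinity> \<longleftrightarrow> a n = 0) \<and>
     (\<forall>n. a n = 0 \<longleftrightarrow> (\<forall>m\<ge>n. a m = 0)) \<and>
     strict_mono_on {n. a n \<noteq> 0} r"

text \<open>
  \<open>series_term a r\<close> is \<open>a / \<lambda>\<^sup>r\<close>; the inverse of \<open>\<lambda>\<^sup>r\<close> in the ring is \<open>\<lambda>\<close> to the power \<open>-r\<close> by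
  the lemma \<open>lambda_powr_minus\<close>. The value for \<open>r = \<infinity>\<close> matters only for \<open>a = 0\<close>, where it is the
  convention \<open>0 / \<lambda>\<^sup>\<infinity> = 0\<close>.
\<close>

definition series_term :: "colombeau \<Rightarrow> ereal \<Rightarrow> colombeau" where
  "series_term a r = (if r = \<infinity> then 0 else a * lambda_powr (- real_of_ereal r))"

definition val_asymptotic_expansion ::
    "colombeau \<Rightarrow> (nat \<Rightarrow> colombeau) \<Rightarrow> (nat \<Rightarrow> ereal) \<Rightarrow> bool" where
  "val_asymptotic_expansion b a r \<longleftrightarrow>
     val_asymptotic_series a r \<and>
     (\<forall>n. a n \<noteq> 0 \<longrightarrow> val (b - (\<Sum>k\<le>n. series_term (a k) (r k))) > r n) \<and>
     (\<forall>n. a n = 0 \<longrightarrow> b = (\<Sum>k<n. series_term (a k) (r k)))"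

end

theory Submission
  imports Defs
begin

text \<open>
  If \<open>val b = 0\<close> and \<open>b\<close> lies outside a maximal space \<open>C\<close>, then \<open>C + \<complex>b\<close> contains an element of
  positive valuation, so \<open>b\<close> is congruent to an element of \<open>C\<close> modulo positive valuation; this element
  is unique because nonzero elements of \<open>C\<close> have valuation \<open>0\<close>. After rescaling by a power of
  \<open>\<lambda>\<close>, every nonzero number thus has exactly one leading term with coefficient in \<open>C\<close>, and
  subtracting leading terms repeatedly gives the expansion. Maximal spaces exist by Zorn's lemma.
\<close>

section \<open>The valuation\<close>

text \<open>Negligible germs lie below every power, so a growth bound does not depend on the
  representative. The supremum defining \<open>val\<close> can then be taken over bounds on the
  quotient.\<close>

lift_definition colombeau_bigo :: "colombeau \<Rightarrow> real \<Rightarrow> bool"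
  is "\<lambda>f r. germ_bigo f (\<lambda>x. 1 / x powr r)"
proof (rule ext)
  fix f g r assume *: "f \<in> moderate \<and> g \<in> moderate \<and> f - g \<in> negligible"
  then have "germ_bigo (f - g) (\<lambda>x. 1 / x powr r)"
    by (simp add: germ_bigo_negligible)
  from germ_bigo_add[OF this, of g] germ_bigo_diff[OF _ this, of f]
  show "germ_bigo f (\<lambda>x. 1 / x powr r) = germ_bigo g (\<lambda>x. 1 / x powr r)" by auto
qed

lemma val_eq_Sup: "val a = Sup (ereal ` {r. colombeau_bigo a r})"
  by transfer (simp add: germ_val_def)

lemma germ_bigo_powr_antimono:
  assumes "germ_bigo f (\<lambda>x. 1 / x powr r)" "s \<le> r"
  shows "germ_bigo f (\<lambda>x. 1 / x powr s)"
  using assms(1)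
proof (rule germ_bigo_mono)
  show "eventually (\<lambda>x. \<bar>1 / x powr r\<bar> \<le> \<bar>1 / x powr s\<bar>) at_top"
    using eventually_ge_at_top[of 1]
  proof eventually_elim
    case (elim x)
    then have "x powr s \<le> x powr r" using assms(2) by (intro powr_mono) auto
    with elim show ?case by (simp add: frac_le)
  qed
qed

lemma colombeau_bigo_antimono: "colombeau_bigo a r \<Longrightarrow> s \<le> r \<Longrightarrow> colombeau_bigo a s"
  by transfer (rule germ_bigo_powr_antimono)

lemma colombeau_bigo_add:
  "colombeau_bigo a r \<Longrightarrow> colombeau_bigo b r \<Longrightarrow> colombeau_bigo (a + b) r"
  by transfer (rule germ_bigo_add)

lemma colombeau_bigo_mult:
  "colombeau_bigo a r \<Longrightarrow> colombeau_bigo b s \<Longrightarrow> colombeau_bigo (a * b) (r + s)"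
proof transfer
  fix f g r s assume "germ_bigo f (\<lambda>x. 1 / x powr r)" "germ_bigo g (\<lambda>x. 1 / x powr s)"
  from germ_bigo_mult[OF this] show "germ_bigo (f * g) (\<lambda>x. 1 / x powr (r + s))"
    by (simp add: powr_add)
qed

lemma colombeau_bigo_const: "colombeau_bigo (const z) 0"
proof transfer
  fix z
  have "germ_bigo (germ_const z) (\<lambda>x. 1)" by transfer simp
  then show "germ_bigo (germ_const z) (\<lambda>x. 1 / x powr 0)"
    by (rule germ_bigo_mono) (auto intro: eventually_mono[OF eventually_gt_at_top[of 0]])
qed

lemma colombeau_bigo_lambda_powr: "colombeau_bigo (lambda_powr s) (- s)"
proof transfer
  fix s
  have "germ_bigo (germ_powr s) (\<lambda>x. x powr s)" by transfer simp
  then show "germ_bigo (germ_powr s) (\<lambda>x. 1 / x powr (- s))"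
    by (simp add: powr_minus divide_inverse)
qed

lemma colombeau_bigo_scale: "colombeau_bigo a r \<Longrightarrow> colombeau_bigo (scale z a) r"
  using colombeau_bigo_mult[OF colombeau_bigo_const] by (fastforce simp: scale_def)

lemma colombeau_bigo_mult_lambda_powr:
  "colombeau_bigo a r \<Longrightarrow> colombeau_bigo (a * lambda_powr s) (r - s)"
  using colombeau_bigo_mult[OF _ colombeau_bigo_lambda_powr, of a r s] by simp

section \<open>Ultrametric inequalities and rescaling\<close>

lemma le_val: "colombeau_bigo a r \<Longrightarrow> ereal r \<le> val a"
  unfolding val_eq_Sup by (rule Sup_upper) auto

text \<open>The inequality must be strict because the supremum need not be attained; below it, every
  exponent is admissible since the admissible set is downward closed.\<close>

lemma less_val: "ereal r < val a \<Longrightarrow> colombeau_bigo a r"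
  unfolding val_eq_Sup less_Sup_iff using colombeau_bigo_antimono by fastforce

text \<open>Real exponents are dense in the extended reals. Testing only reals strictly below
  \<open>y\<close> lets \<open>less_val\<close> and \<open>le_val\<close> be chained although the
  supremum may not be attained.\<close>

lemma le_valI:
  assumes "\<And>r. ereal r < y \<Longrightarrow> ereal r \<le> val a"
  shows "y \<le> val a"
proof (rule dense_le)
  fix x assume "x < y" then show "x \<le> val a"
    using assms by (cases x) auto
qed

lemma val_add: "min (val a) (val b) \<le> val (a + b)"
  by (rule le_valI) (simp add: le_val colombeau_bigo_add less_val)

lemma val_scale_le: "val a \<le> val (scale z a)"
  by (rule le_valI) (simp add: le_val colombeau_bigo_scale less_val)

lemma val_scale: "z \<noteq> 0 \<Longrightarrow> val (scale z a) = val a"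
  using val_scale_le[of a z] val_scale_le[of "scale z a" "inverse z"] by simp

lemma val_uminus: "val (- a) = val a"
  using val_scale[of "-1" a] by simp

lemma val_diff: "min (val a) (val b) \<le> val (a - b)"
  using val_add[of a "- b"] by (simp add: val_uminus)

text \<open>The isosceles triangle principle of ultrametrics: apply the ultrametric inequality to b
  = a - (a - b) and to a = (a - b) + b.\<close>

lemma val_eq_if_val_diff_gt:
  assumes "val a < val (a - b)"
  shows "val b = val a"
proof -
  have "min (val a) (val (a - b)) \<le> val b" using val_diff[of a "a - b"] by simp
  moreover have "min (val (a - b)) (val b) \<le> val a" using val_add[of "a - b" b] by simp
  ultimately show ?thesis using assms by (auto simp: min_def split: if_splits)
qed

lemma val_mult_lambda_powr_ge: "val a - ereal s \<le> val (a * lambda_powr s)"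
proof (rule le_valI)
  fix r assume "ereal r < val a - ereal s"
  then have "ereal (r + s) < val a" by (cases "val a") auto
  from colombeau_bigo_mult_lambda_powr[OF less_val[OF this], of s]
  show "ereal r \<le> val (a * lambda_powr s)" by (simp add: le_val)
qed

lemma mult_lambda_powr_cancel [simp]: "a * lambda_powr r * lambda_powr (- r) = a"
  by (simp add: mult.assoc lambda_powr_minus)

text \<open>Multiplication by \<open>lambda_powr s\<close> is undone by
  \<open>lambda_powr (- s)\<close>, so the one-sided estimate for both gives equality.\<close>

lemma val_mult_lambda_powr: "val (a * lambda_powr s) = val a - ereal s"
  using val_mult_lambda_powr_ge[of a s] val_mult_lambda_powr_ge[of "a * lambda_powr s" "- s"]
  by (cases "val a"; cases "val (a * lambda_powr s)") auto

section \<open>Infinite, finite and zero valuation\<close>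

lemma val_0 [simp]: "val 0 = \<infinity>"
proof -
  have "colombeau_bigo 0 r" for r by transfer (rule germ_bigo_zero)
  then have "ereal r \<le> val 0" for r by (rule le_val)
  then have "\<infinity> \<le> val 0" by (rule le_valI)
  then show ?thesis by simp
qed

lemma val_eq_PInf_iff [simp]: "val a = \<infinity> \<longleftrightarrow> a = 0"
proof
  assume "val a = \<infinity>"
  then have "\<forall>r. colombeau_bigo a r" by (simp add: less_val)
  then show "a = 0"
  proof transfer
    fix f assume f: "f \<in> moderate \<and> f \<in> moderate \<and> f - f \<in> negligible"
      "\<forall>r. germ_bigo f (\<lambda>x. 1 / x powr r)"
    have "germ_bigo f (\<lambda>x. 1 / x ^ n)" for n
    proof (rule germ_bigo_mono)
      show "germ_bigo f (\<lambda>x. 1 / x powr real n)" using f by blast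
      show "eventually (\<lambda>x. \<bar>1 / x powr real n\<bar> \<le> \<bar>1 / x ^ n\<bar>) at_top"
        using eventually_gt_at_top[of 0] by eventually_elim (simp add: powr_realpow)
    qed
    with f show "f \<in> moderate \<and> 0 \<in> moderate \<and> f - 0 \<in> negligible"
      by (simp add: negligible_def moderate_0)
  qed
qed simp

lemma val_neq_MInf [simp]: "val a \<noteq> -\<infinity>"
proof -
  have "\<exists>r. colombeau_bigo a r"
  proof transfer
    fix f assume "f \<in> moderate \<and> f \<in> moderate \<and> f - f \<in> negligible"
    then obtain n where n: "germ_bigo f (\<lambda>x. x ^ n)" by (auto simp: moderate_def)
    have "germ_bigo f (\<lambda>x. 1 / x powr (- real n))"
    proof (rule germ_bigo_mono[OF n])
      show "eventually (\<lambda>x. \<bar>x ^ n\<bar> \<le> \<bar>1 / x powr (- real n)\<bar>) at_top"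
        using eventually_gt_at_top[of 0]
        by eventually_elim (simp add: powr_minus powr_realpow divide_inverse)
    qed
    then show "\<exists>r. germ_bigo f (\<lambda>x. 1 / x powr r)" by blast
  qed
  then show ?thesis using le_val[of a] by fastforce
qed

lemma val_1: "val 1 = 0"
proof -
  have "colombeau_bigo 1 0" using colombeau_bigo_const[of 1] by (simp add: const_1)
  then have "0 \<le> val 1" using le_val zero_ereal_def by metis
  moreover have "\<not> 0 < val 1"
  proof
    assume "0 < val 1"
    moreover obtain t where t: "val 1 = ereal t" by (cases "val 1") auto
    ultimately have "t > 0" by simp
    \<comment> \<open>Since 1 * 1 = 1, any admissible exponent may be doubled; 3t/4 lies below t,
      but its double 3t/2 lies above it.\<close>
    then have "colombeau_bigo 1 (3 * t / 4)" by (intro less_val) (simp add: t)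
    from le_val[OF colombeau_bigo_mult[OF this this]] \<open>t > 0\<close> show False by (simp add: t)
  qed
  ultimately show ?thesis by simp
qed

lemma val_const: "z \<noteq> 0 \<Longrightarrow> val (const z) = 0"
  using val_scale[of z 1] by (simp add: scale_def val_1)


section \<open>Leading terms\<close>

lemma maximal_in_val_zeroD:
  assumes "maximal_in_val_zero C"
  shows "colombeau.subspace C" "C \<subseteq> val_zero \<union> {0}"
    "\<And>K. colombeau.subspace K \<Longrightarrow> C \<subset> K \<Longrightarrow> \<not> K \<subseteq> val_zero \<union> {0}"
  using assms unfolding maximal_in_val_zero_def by blast+

lemma maximal_val_eq_0: "maximal_in_val_zero C \<Longrightarrow> c \<in> C \<Longrightarrow> c \<noteq> 0 \<Longrightarrow> val c = 0"
  by (drule maximal_in_val_zeroD(2)) (auto simp: val_zero_def)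

lemma ex_leading_coefficient:
  assumes C: "maximal_in_val_zero C" and b: "b \<noteq> 0"
  shows "\<exists>c\<in>C. c \<noteq> 0 \<and> val b < val (b - series_term c (val b))"
proof -
  obtain s where s: "val b = ereal s" using b by (cases "val b") auto
  \<comment> \<open>Rescaling moves the valuation to 0, where maximality of \<open>C\<close>
    applies.\<close>
  define d where "d = b * lambda_powr s"
  have d: "val d = 0" by (simp add: d_def val_mult_lambda_powr s zero_ereal_def)
  note sub = maximal_in_val_zeroD(1)[OF C] and C0 = maximal_in_val_zeroD(2)[OF C]
    and max = maximal_in_val_zeroD(3)[OF C]
  have "\<exists>c\<in>C. 0 < val (d - c)"
  proof (cases "d \<in> C")
    case True
    then show ?thesis by (intro bexI[of _ d]) auto
  next
    case False
    let ?K = "colombeau.span (insert d C)"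
    have "C \<subset> ?K" using False colombeau.span_superset[of "insert d C"] by auto
    with max[OF colombeau.subspace_span] obtain e where e: "e \<in> ?K" "e \<noteq> 0" "val e \<noteq> 0"
      by (auto simp: val_zero_def)
    from e(1) obtain z where "e - scale z d \<in> colombeau.span C"
      by (auto simp: colombeau.span_breakdown_eq)
    then have z: "e - scale z d \<in> C" using colombeau.span_minimal[OF order_refl sub] by blast
    \<comment> \<open>For z = 0 the nonzero \<open>e\<close> would lie in \<open>C\<close> and so
      have valuation 0.\<close>
    have "z \<noteq> 0" using z e C0 by (auto simp: val_zero_def)
    \<comment> \<open>Solving for \<open>d\<close> modulo \<open>e\<close>: this choice makes d - c
      equal to e / z.\<close>
    define c where "c = scale (- inverse z) (e - scale z d)"
    have c: "c \<in> C" using z sub by (simp only: c_def colombeau.subspace_scale)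
    have "d - c = scale (inverse z) e"
      using \<open>z \<noteq> 0\<close> by (simp add: c_def colombeau.scale_right_diff_distrib)
    then have "val (d - c) \<noteq> 0" using e \<open>z \<noteq> 0\<close> by (simp add: val_scale)
    \<comment> \<open>Both \<open>d\<close> and \<open>c\<close> have nonnegative valuation, hence
      so does d - c; being nonzero, that valuation is positive.\<close>
    moreover have "0 \<le> val c" using c C0 by (auto simp: val_zero_def)
    then have "0 \<le> val (d - c)" using val_diff[of d c] d by simp
    ultimately show ?thesis using c by force
  qed
  then obtain c where c: "c \<in> C" "0 < val (d - c)" by blast
  have "c \<noteq> 0" using c d by auto
  have "b - series_term c (val b) = (d - c) * lambda_powr (- s)"
    by (simp add: series_term_def s d_def left_diff_distrib)
  then have "val (b - series_term c (val b)) = val (d - c) + ereal s"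
    by (simp add: val_mult_lambda_powr minus_ereal_def)
  with c(2) have "val b < val (b - series_term c (val b))"
    by (cases "val (d - c)") (simp_all add: s del: val_eq_PInf_iff)
  with c \<open>c \<noteq> 0\<close> show ?thesis by blast
qed

lemma val_series_term:
  assumes "maximal_in_val_zero C" "c \<in> C" "c \<noteq> 0" "r \<noteq> \<infinity>" "r \<noteq> -\<infinity>"
  shows "val (series_term c r) = r"
proof -
  have "val c = 0" using assms by (simp add: maximal_val_eq_0)
  then show ?thesis using assms(4,5)
    by (cases r) (auto simp: series_term_def val_mult_lambda_powr zero_ereal_def)
qed

text \<open>The term has valuation exactly \<open>r\<close> and the rest a larger one, so the
  isosceles principle applies. The exponent of a leading term is thus determined by \<open>b\<close>
  alone.\<close>

lemma leading_term_val:
  assumes "maximal_in_val_zero C" "c \<in> C" "c \<noteq> 0" "r \<noteq> \<infinity>" "r \<noteq> -\<infinity>"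
    and "r < val (b - series_term c r)"
  shows "val b = r"
  using val_eq_if_val_diff_gt[of "series_term c r" b] val_uminus[of "b - series_term c r"]
    val_series_term[OF assms(1-5)] assms(6) by simp

text \<open>Subtracting the two remainders leaves (d - c) / \<lambda>^r with valuation above
  \<open>r\<close>. Hence d - c is an element of \<open>C\<close> of positive valuation, which can
  only be 0.\<close>

lemma leading_coefficient_unique:
  assumes C: "maximal_in_val_zero C" and "c \<in> C" "d \<in> C" "r \<noteq> \<infinity>" "r \<noteq> -\<infinity>"
    and "r < val (b - series_term c r)" "r < val (b - series_term d r)"
  shows "c = d"
proof -
  obtain s where s: "r = ereal s" using assms by (cases r) auto
  have "r < val ((b - series_term c r) - (b - series_term d r))"
    using assms by (intro order.strict_trans2[OF _ val_diff]) simp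
  also have "(b - series_term c r) - (b - series_term d r) = (d - c) * lambda_powr (- s)"
    by (simp add: series_term_def s left_diff_distrib)
  finally have "val (d - c) \<noteq> 0"
    by (auto simp: val_mult_lambda_powr s)
  moreover have "d - c \<in> C"
    using maximal_in_val_zeroD(1)[OF C] assms(2,3) by (simp add: colombeau.subspace_diff)
  ultimately show ?thesis
    using maximal_val_eq_0[OF C, of "d - c"] by auto
qed


section \<open>Existence and uniqueness of expansions\<close>

lemma ex_expansion:
  assumes C: "maximal_in_val_zero C"
  shows "\<exists>c r. val_asymptotic_expansion b c r \<and> range c \<subseteq> C"
proof -
  note sub = maximal_in_val_zeroD(1)[OF C]
  note 0 = colombeau.subspace_0[OF sub]
  \<comment> \<open>Including the number 0 with coefficient 0 makes the choice function total, and a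
    coefficient vanishes exactly when the remainder does.\<close>
  have "\<forall>a. \<exists>c. c \<in> C \<and> (c = 0 \<longleftrightarrow> a = 0) \<and>
      (a \<noteq> 0 \<longrightarrow> val a < val (a - series_term c (val a)))"
    using ex_leading_coefficient[OF C] 0 by (metis (no_types))
  from choice[OF this] obtain f where f: "\<And>a. f a \<in> C" "\<And>a. f a = 0 \<longleftrightarrow> a = 0"
    "\<And>a. a \<noteq> 0 \<Longrightarrow> val a < val (a - series_term (f a) (val a))"
    by blast
  \<comment> \<open>\<open>R n\<close> is the remainder after \<open>n\<close> leading terms. Once
    it is 0 its valuation is infinite, \<open>series_term\<close> returns 0, and the recursion stays
    at 0: a finite expansion.\<close>
  define R where "R = rec_nat b (\<lambda>_ a. a - series_term (f a) (val a))"
  have R0: "R 0 = b" and R_Suc: "\<And>n. R (Suc n) = R n - series_term (f (R n)) (val (R n))"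
    by (simp_all add: R_def)
  define c r where "c = (\<lambda>n. f (R n))" and "r = (\<lambda>n. val (R n))"
  have R: "R n = b - (\<Sum>k<n. series_term (c k) (r k))" for n
    by (induction n) (simp_all add: R0 R_Suc c_def r_def)
  have step: "r n \<le> r (Suc n)" for n
    using f(3)[of "R n"] by (cases "R n = 0") (auto simp: r_def R_Suc series_term_def)
  then have mono: "m \<le> n \<Longrightarrow> r m \<le> r n" for m n
    by (rule lift_Suc_mono_le)
  have r_less: "r n < r (Suc n)" if "c n \<noteq> 0" for n
    using f(2,3)[of "R n"] that by (simp add: r_def c_def R_Suc)
  have c0: "c n = 0 \<longleftrightarrow> r n = \<infinity>" for n
    by (simp add: c_def r_def f(2))
  have C_range: "range c \<subseteq> C" using f(1) by (auto simp: c_def)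
  \<comment> \<open>Independence is inherited from \<open>C\<close>: all combinations of the
    coefficients stay in it.\<close>
  have "colombeau.span (range c) \<subseteq> C" using C_range sub by (rule colombeau.span_minimal)
  then have "lin_val_independent (range c)"
    using maximal_val_eq_0[OF C] by (auto simp: lin_val_independent_def)
  moreover have "strict_mono_on {n. c n \<noteq> 0} r"
  proof (rule strict_mono_onI)
    fix m n assume "m \<in> {n. c n \<noteq> 0}" "m < n"
    then show "r m < r n" using r_less[of m] mono[of "Suc m" n] by simp
  qed
  \<comment> \<open>An infinite exponent stays infinite by monotonicity, so a zero coefficient is
    followed only by zeros.\<close>
  moreover have "\<forall>n. c n = 0 \<longleftrightarrow> (\<forall>m\<ge>n. c m = 0)"
    using mono by (fastforce simp: c0)
  moreover have "\<forall>n. r n \<noteq> -\<infinity>" by (simp add: r_def)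
  ultimately have "val_asymptotic_series c r"
    unfolding val_asymptotic_series_def using c0 by blast
  moreover have "r n < val (b - (\<Sum>k\<le>n. series_term (c k) (r k)))" if "c n \<noteq> 0" for n
    using r_less[OF that] R[of "Suc n"] by (simp add: r_def lessThan_Suc_atMost)
  moreover have "b = (\<Sum>k<n. series_term (c k) (r k))" if "c n = 0" for n
    using that R[of n] by (simp add: c_def f(2))
  ultimately have "val_asymptotic_expansion b c r"
    unfolding val_asymptotic_expansion_def by blast
  with C_range show ?thesis by blast
qed

lemma val_asymptotic_expansionD:
  assumes "val_asymptotic_expansion b c r"
  shows "r n \<noteq> -\<infinity>" "r n = \<infinity> \<longleftrightarrow> c n = 0"
    "c n \<noteq> 0 \<Longrightarrow> r n < val (b - (\<Sum>k\<le>n. series_term (c k) (r k)))"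
    "c n = 0 \<Longrightarrow> b = (\<Sum>k<n. series_term (c k) (r k))"
  using assms unfolding val_asymptotic_expansion_def val_asymptotic_series_def by blast+

text \<open>Every expansion over \<open>C\<close> must follow the greedy recursion of the existence
  proof. The first equation also covers termination, where both sides are infinite. A separate
  \<open>R\<close> allows two expansions to share one remainder.\<close>

lemma expansion_leading_term:
  assumes C: "maximal_in_val_zero C" and e: "val_asymptotic_expansion b c r" "range c \<subseteq> C"
    and R: "R = b - (\<Sum>k<n. series_term (c k) (r k))"
  shows "r n = val R" "c n \<noteq> 0 \<Longrightarrow> r n < val (R - series_term (c n) (r n))"
proof -
  note D = val_asymptotic_expansionD[OF e(1), of n]
  have "R - series_term (c n) (r n) = b - (\<Sum>k\<le>n. series_term (c k) (r k))"
    by (simp add: R lessThan_Suc_atMost[symmetric])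
  with D(3) show 1: "r n < val (R - series_term (c n) (r n))" if "c n \<noteq> 0"
    using that by simp
  show "r n = val R"
  proof (cases "c n = 0")
    case True
    then have "R = 0" using D(4) R by simp
    with True D(2) show ?thesis by simp
  next
    case False
    have "c n \<in> C" using e(2) by auto
    from leading_term_val[OF C this False _ D(1) 1[OF False]] False D(2) show ?thesis by simp
  qed
qed

text \<open>By strong induction, equal earlier terms leave a common remainder. Its valuation fixes
  the exponent, and an infinite exponent means that both coefficients vanish; otherwise uniqueness
  of leading coefficients applies.\<close>

lemma expansion_unique:
  assumes C: "maximal_in_val_zero C"
    and e: "val_asymptotic_expansion b c r" "range c \<subseteq> C"
    and e': "val_asymptotic_expansion b c' r'" "range c' \<subseteq> C"
  shows "c = c' \<and> r = r'"
proof -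
  have "c n = c' n \<and> r n = r' n" for n
  proof (induction n rule: less_induct)
    case (less n)
    define R where R: "R = b - (\<Sum>k<n. series_term (c k) (r k))"
    have R': "R = b - (\<Sum>k<n. series_term (c' k) (r' k))"
      using less by (simp add: R)
    note l = expansion_leading_term[OF C e R] and l' = expansion_leading_term[OF C e' R']
    have r: "r n = r' n" using l(1) l'(1) by simp
    note D = val_asymptotic_expansionD[OF e(1), of n]
      and D' = val_asymptotic_expansionD[OF e'(1), of n]
    have "c n = c' n"
    proof (cases "c n = 0")
      case True
      then show ?thesis using D(2) D'(2) r by simp
    next
      case False
      then have "r n \<noteq> \<infinity>" "c' n \<noteq> 0" using D(2) D'(2) r by simp_all
      moreover have "c n \<in> C" "c' n \<in> C" using e e' by auto
      ultimately show ?thesis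
        using leading_coefficient_unique[OF C, of "c n" "c' n" "r n" R] D(1) l(2) l'(2) r False
        by simp
    qed
    with r show ?case by simp
  qed
  then show ?thesis by auto
qed


section \<open>Existence of maximal subspaces\<close>

lemma subspace_range_const: "colombeau.subspace (range const)"
proof -
  have "const 0 = 0"
    using const_add[of 0 0] by simp
  then have "0 \<in> range const" by (metis rangeI)
  then show ?thesis
    by (auto simp: colombeau.subspace_def scale_def const_add[symmetric] const_mult[symmetric])
qed

lemma subspace_Union_chain:
  assumes "subset.chain (Collect colombeau.subspace) A" "A \<noteq> {}"
  shows "colombeau.subspace (\<Union>A)"
proof (rule colombeau.subspaceI)
  have sub: "colombeau.subspace K" if "K \<in> A" for K
    using assms that by (auto simp: subset_chain_def)
  show "0 \<in> \<Union>A" using assms(2) sub colombeau.subspace_0 by auto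
  show "scale z x \<in> \<Union>A" if "x \<in> \<Union>A" for z x
    using that sub colombeau.subspace_scale by blast
  show "x + y \<in> \<Union>A" if xy: "x \<in> \<Union>A" "y \<in> \<Union>A" for x y
  proof -
    obtain K L where "K \<in> A" "L \<in> A" "x \<in> K" "y \<in> L" using xy by auto
    \<comment> \<open>In a chain the larger of \<open>K\<close> and \<open>L\<close> contains both
      vectors.\<close>
    then obtain M where "M \<in> A" "x \<in> M" "y \<in> M"
      using assms(1) unfolding subset_chain_def by (meson subsetD)
    then show ?thesis using sub colombeau.subspace_add by blast
  qed
qed

lemma ex_maximal_in_val_zero: "\<exists>C. maximal_in_val_zero C"
proof -
  define S where "S = {K. colombeau.subspace K \<and> range const \<subseteq> K \<and> K \<subseteq> val_zero \<union> {0}}"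
  have "const z \<in> val_zero \<union> {0}" for z
    using val_const[of z] const_add[of 0 0] by (cases "z = 0") (auto simp: val_zero_def)
  then have "range const \<in> S" using subspace_range_const by (auto simp: S_def)
  then have "S \<noteq> {}" by blast
  moreover have "\<Union>A \<in> S" if A: "A \<noteq> {}" "subset.chain S A" for A
  proof -
    have "A \<subseteq> S" using A by (simp add: subset_chain_def)
    moreover have "colombeau.subspace (\<Union>A)"
      using A by (intro subspace_Union_chain) (auto simp: subset_chain_def S_def)
    ultimately show ?thesis using A(1) by (fastforce simp: S_def)
  qed
  ultimately obtain C where "C \<in> S" "\<And>K. K \<in> S \<Longrightarrow> C \<subseteq> K \<Longrightarrow> K = C"
    using subset_Zorn_nonempty[of S] by metis
  \<comment> \<open>Any larger competitor contains \<open>C\<close>, hence the constants, and so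
    belongs to \<open>S\<close>; maximality within \<open>S\<close> is therefore enough.\<close>
  then have "maximal_in_val_zero C"
    by (auto simp: maximal_in_val_zero_def S_def)
  then show ?thesis ..
qed

theorem theorem12:
  "(\<forall>a. \<exists>c r. val_asymptotic_expansion a c r) \<and>
   (\<forall>C. maximal_in_val_zero C \<longrightarrow>
      (\<forall>a. \<exists>!(c, r). val_asymptotic_expansion a c r \<and> range c \<subseteq> C))"
proof (intro conjI allI impI)
  show "\<exists>c r. val_asymptotic_expansion a c r" for a
    using ex_maximal_in_val_zero ex_expansion by blast
next
  fix C a assume C: "maximal_in_val_zero C"
  then obtain c r where "val_asymptotic_expansion a c r \<and> range c \<subseteq> C"
    using ex_expansion by blast
  then show "\<exists>!(c, r). val_asymptotic_expansion a c r \<and> range c \<subseteq> C"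
    using expansion_unique[OF C] by (intro ex1I[of _ "(c, r)"]) auto
qed

end
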